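(* Let $2\le p<\infty$ and $\epsilon<p-1$ be real numbers, and put $$b_0=\exp\left[\frac{\sqrt2\,\pi\,p(p-1)}{p-1-\epsilon}\right].$$ Define $$C_1=\begin{cases}\pi^2\left(\frac{p}{p-1-\epsilon}\right)^{p+2}\left(p-\frac78\right), & 2\le p\le 3,\\[4pt] \pi^2\left(\frac{p}{p-1-\epsilon}\right)^{p+2}\left(2p^2-4p+1\right), & 3<p<\infty,\end{cases}$$ and $$C_2=\frac{2\pi^2(p-1)^2\left(\frac{p}{p-1-\epsilon}\right)^{p+2}\left(\arctan\frac{1}{\sqrt{2(p-2)}}\right)^2}{4\pi^2(p-1)+\left(\arctan\frac{1}{\sqrt{2(p-2)}}\right)^2},$$ where for $p=2$ the quantity $\arctan\frac{1}{\sqrt{2(p-2)}}$ is understood as $\frac{\pi}{2}$. Then for all $0<a<b<\infty$ with $b/a>b_0$, $$\left(\frac{p}{p-1-\epsilon}\right)^p-\frac{C_1}{\ln^2\frac ba}\ \le\ d(a,b,p,\epsilon)\ \le\ \left(\frac{p}{p-1-\epsilon}\right)^p-\frac{C_2}{\ln^2\frac ba}.$$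
   Context: For $0<a<b<\infty$, $p>1$ and $\epsilon<p-1$, $d(a,b,p,\epsilon)$ denotes the smallest possible constant $d$ such that the finite weighted Hardy inequality $$\int_a^b\left(\frac1x\int_a^x f(t)\,dt\right)^p x^{\epsilon}\,dx\le d\int_a^b [f(x)]^p x^{\epsilon}\,dx$$ holds for all measurable functions $f\ge 0$ on $(a,b)$ such that $f(x)^p x^{\epsilon}$ is integrable over $(a,b)$. Here $\ln^2 y$ means $(\ln y)^2$. *)

theory Defs
  imports "HOL-Analysis.Analysis"
begin

definition hardy_admissible :: "real \<Rightarrow> real \<Rightarrow> real \<Rightarrow> real \<Rightarrow> (real \<Rightarrow> real) \<Rightarrow> bool" where
  "hardy_admissible a b p \<epsilon> f \<longleftrightarrow>
     set_borel_measurable lebesgue {a<..<b} f \<and>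
     (\<forall>x\<in>{a<..<b}. 0 \<le> f x) \<and>
     set_integrable lebesgue {a<..<b} (\<lambda>x. f x powr p * x powr \<epsilon>)"

text \<open>
  The integrals below are Bochner integrals, which are 0 for non-integrable functions. This
  convention never takes effect for 0 < a < b and p > 1: the weight is bounded away from 0 and
  infinity on (a, b), so by Hoelder's inequality an admissible f is integrable on (a, b), and
  the integrand on the left-hand side is then continuous and bounded.
\<close>

definition hardy_inequality :: "real \<Rightarrow> real \<Rightarrow> real \<Rightarrow> real \<Rightarrow> real \<Rightarrow> bool" where
  "hardy_inequality a b p \<epsilon> d \<longleftrightarrow>
     (\<forall>f. hardy_admissible a b p \<epsilon> f \<longrightarrow>
        (LINT x:{a<..<b}|lebesgue. ((1 / x) * (LINT t:{a<..<x}|lebesgue. f t)) powr p * x powr \<epsilon>)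
          \<le> d * (LINT x:{a<..<b}|lebesgue. f x powr p * x powr \<epsilon>))"

definition hardy_const :: "real \<Rightarrow> real \<Rightarrow> real \<Rightarrow> real \<Rightarrow> real" where
  "hardy_const a b p \<epsilon> = (LEAST d. hardy_inequality a b p \<epsilon> d)"

definition hardy_b0 :: "real \<Rightarrow> real \<Rightarrow> real" where
  "hardy_b0 p \<epsilon> = exp (sqrt 2 * pi * p * (p - 1) / (p - 1 - \<epsilon>))"

definition hardy_C1 :: "real \<Rightarrow> real \<Rightarrow> real" where
  "hardy_C1 p \<epsilon> =
     (if p \<le> 3 then pi\<^sup>2 * (p / (p - 1 - \<epsilon>)) powr (p + 2) * (p - 7 / 8)
      else pi\<^sup>2 * (p / (p - 1 - \<epsilon>)) powr (p + 2) * (2 * p\<^sup>2 - 4 * p + 1))"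

text \<open>
  The case p = 2 is separate because division by zero would give arctan 0 = 0
  instead of the limit value pi / 2.
\<close>

definition hardy_angle :: "real \<Rightarrow> real" where
  "hardy_angle p = (if p = 2 then pi / 2 else arctan (1 / sqrt (2 * (p - 2))))"

definition hardy_C2 :: "real \<Rightarrow> real \<Rightarrow> real" where
  "hardy_C2 p \<epsilon> =
     (2 * pi\<^sup>2 * (p - 1)\<^sup>2 * (p / (p - 1 - \<epsilon>)) powr (p + 2) * (hardy_angle p)\<^sup>2)
       / (4 * pi\<^sup>2 * (p - 1) + (hardy_angle p)\<^sup>2)"

end

(* Writing k = (p - 1 - \<epsilon>) / p, the constant p / (p - 1 - \<epsilon>) is 1 / k and the extremal x powr k only just
   fails; both bounds come from modulating it by a trigonometric function of ln x. A supersolution G with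
   G powr (p - 1) = x powr (k (p - 1)) cos (\<kappa> ln (b / x)), where \<kappa> ln (b / a) < pi / 2, gives the constant
   k powr (- p) / (1 + \<kappa>^2 / k^2): the integral of G powr (p - 1) is explicit, and the remaining pointwise
   condition is Bernoulli's inequality. Conversely, testing with the positive part of the derivative of
   x powr k sin (\<nu> ln (x / a)), \<nu> = pi / ln (b / a), gives at least (k^2 + \<nu>^2) powr (- p / 2), because
   k sin + \<nu> cos is a multiple of a shifted sine. *)
theory Submission
  imports Defs
begin

section \<open>Bernoulli-type inequalities for real exponents\<close>

lemma one_plus_powr_ge:
  fixes h s :: real
  assumes "0 \<le> h" "1 \<le> s"
  shows "1 + s * h \<le> (1 + h) powr s"
proof (cases "s = 1")
  case False
  then have s: "s > 1" using assms by simp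
  \<comment> \<open>Young's inequality with conjugate exponents \<open>s\<close> and
    \<open>s / (s - 1)\<close> and second factor 1 is Bernoulli's inequality divided by
    \<open>s\<close>.\<close>
  have "(1 + h) * 1 \<le> (1 + h) powr s / s + 1 powr (s / (s - 1)) / (s / (s - 1))"
    by (rule Youngs_inequality) (use s assms in \<open>auto simp: field_simps\<close>)
  then have "s * (1 + s * h) \<le> s * (1 + h) powr s" using s by (simp add: field_simps)
  then show ?thesis using s by simp
qed (use assms in simp)

text \<open>Two tangent-line bounds combine: \<open>ln (1 + z) \<le> z\<close>, and
  \<open>exp\<close> lies above its tangent at 0.\<close>

lemma one_plus_powr_minus_ge:
  fixes z r :: real
  assumes "0 \<le> z" "0 \<le> r"
  shows "1 - r * z \<le> (1 + z) powr (- r)"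
proof -
  have "1 - r * z \<le> 1 + (- r) * ln (1 + z)"
    using assms ln_add_one_self_le_self[of z] by (simp add: mult_left_mono)
  also have "\<dots> \<le> exp ((- r) * ln (1 + z))" by (rule exp_ge_add_one_self)
  finally show ?thesis using assms by (simp add: powr_def)
qed

section \<open>A weighted Hardy criterion for Lebesgue measure\<close>

text \<open>Tonelli is applied below to \<open>lebesgue\<close>, the completion of
  \<open>lborel\<close>. A countable cover by sets of finite measure keeps its measures under
  completion.\<close>

lemma sigma_finite_completion:
  assumes "sigma_finite_measure M"
  shows "sigma_finite_measure (completion M)"
proof -
  interpret sigma_finite_measure M by fact
  obtain A where "countable A" "A \<subseteq> sets M" "\<Union>A = space M" "\<forall>a\<in>A. emeasure M a \<noteq> \<infinity>"
    using sigma_finite_countable by blast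
  then have "countable A \<and> A \<subseteq> sets (completion M) \<and> \<Union>A = space (completion M) \<and>
      (\<forall>a\<in>A. emeasure (completion M) a \<noteq> \<infinity>)"
    by (auto intro: sets_completionI_sets simp: subset_iff)
  then show ?thesis
    unfolding sigma_finite_measure_def by blast
qed

text \<open>This is Hoelder's inequality for the splitting of f into
  \<open>f * \<gamma> powr ((1 - p) / p)\<close> and \<open>\<gamma> powr ((p - 1) / p)\<close>,
  with G in place of the integral of \<open>\<gamma>\<close>. Integrability of f is not assumed:
  otherwise its Bochner integral is 0 and the claim is trivial.\<close>

lemma integral_powr_le_weighted:
  fixes f \<gamma> :: "'a \<Rightarrow> real" and p G :: real
  assumes p: "1 < p" and G: "0 < G"
    and [measurable]: "f \<in> borel_measurable M" "\<gamma> \<in> borel_measurable M"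
    and f: "\<And>x. x \<in> space M \<Longrightarrow> 0 \<le> f x" and \<gamma>: "\<And>x. x \<in> space M \<Longrightarrow> 0 < \<gamma> x"
    and le: "(\<integral>\<^sup>+x. \<gamma> x \<partial>M) \<le> ennreal G"
  shows "ennreal ((\<integral>x. f x \<partial>M) powr p)
    \<le> ennreal (G powr (p - 1)) * (\<integral>\<^sup>+x. f x powr p * \<gamma> x powr (1 - p) \<partial>M)"
proof (cases "integrable M f \<and> (\<integral>\<^sup>+x. f x powr p * \<gamma> x powr (1 - p) \<partial>M) < \<infinity> \<and> (\<integral>x. f x \<partial>M) > 0")
  case True
  define F where "F = (\<integral>x. f x \<partial>M)"
  define J where "J = (\<integral>x. f x powr p * \<gamma> x powr (1 - p) \<partial>M)"
  have F: "F > 0" using True by (simp add: F_def)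
  have int\<gamma>: "integrable M \<gamma>"
    using le \<gamma> by (intro integrableI_nonneg) (auto intro!: AE_I2 less_imp_le simp: top.not_eq_extremum
       intro: le_less_trans[OF _ ennreal_less_top])
  have intJ: "integrable M (\<lambda>x. f x powr p * \<gamma> x powr (1 - p))"
    using True by (intro integrableI_nonneg) auto
  have G': "(\<integral>x. \<gamma> x \<partial>M) \<le> G"
    using le G \<gamma> by (subst (asm) nn_integral_eq_integral[OF int\<gamma>])
      (auto intro!: AE_I2 less_imp_le simp: ennreal_le_iff)
  have J: "(\<integral>\<^sup>+x. f x powr p * \<gamma> x powr (1 - p) \<partial>M) = ennreal J"
    unfolding J_def using intJ by (intro nn_integral_eq_integral) auto
  \<comment> \<open>The optimal parameter in the pointwise Young inequality \<open>pt\<close>: since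
    \<open>r powr p * G = F * r powr (p - 1)\<close>, the second term after integration is the
    fraction \<open>(p - 1) / p\<close> of the left side and can be absorbed there.\<close>
  define r where "r = F / G"
  have r: "r > 0" using F G by (simp add: r_def)
  have pt: "f x * r powr (p - 1) \<le> f x powr p * \<gamma> x powr (1 - p) / p + (p - 1) / p * r powr p * \<gamma> x"
    if x: "x \<in> space M" for x
  proof -
    have "f x / \<gamma> x * r powr (p - 1)
        \<le> (f x / \<gamma> x) powr p / p + (r powr (p - 1)) powr (p / (p - 1)) / (p / (p - 1))"
      by (rule Youngs_inequality)
        (use p f[OF x] \<gamma>[OF x] in \<open>auto simp: field_simps\<close>)
    also have "(r powr (p - 1)) powr (p / (p - 1)) / (p / (p - 1)) = (p - 1) / p * r powr p"
      using p by (simp add: powr_powr)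
    finally have "\<gamma> x * (f x / \<gamma> x * r powr (p - 1))
        \<le> \<gamma> x * ((f x / \<gamma> x) powr p / p + (p - 1) / p * r powr p)"
      using \<gamma>[OF x] by (intro mult_left_mono) auto
    moreover have "\<gamma> x * (f x / \<gamma> x) powr p = f x powr p * \<gamma> x powr (1 - p)"
      using f[OF x] \<gamma>[OF x] by (simp add: powr_divide powr_diff)
    ultimately show ?thesis
      using \<gamma>[OF x] by (simp add: algebra_simps)
  qed
  have "F * r powr (p - 1) = (\<integral>x. f x * r powr (p - 1) \<partial>M)"
    by (simp add: F_def)
  also have "\<dots> \<le> (\<integral>x. f x powr p * \<gamma> x powr (1 - p) / p + (p - 1) / p * r powr p * \<gamma> x \<partial>M)"
    using True intJ int\<gamma> by (intro integral_mono pt) auto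
  also have "\<dots> = J / p + (p - 1) / p * r powr p * (\<integral>x. \<gamma> x \<partial>M)"
    using intJ int\<gamma> by (subst Bochner_Integration.integral_add) (auto simp: J_def)
  also have "\<dots> \<le> J / p + (p - 1) / p * r powr p * G"
    using G' p by (intro add_left_mono mult_left_mono) auto
  also have "r powr p * G = F * r powr (p - 1)"
    using F r G by (simp add: powr_diff r_def)
  then have "(p - 1) / p * r powr p * G = (p - 1) / p * (F * r powr (p - 1))"
    by (simp only: mult.assoc)
  finally have "F * r powr (p - 1) / p \<le> J / p"
    using p by (simp add: field_simps)
  then have "F * r powr (p - 1) \<le> J" using p by (simp add: field_simps)
  then have "F powr p \<le> G powr (p - 1) * J"
    using F G by (simp add: r_def powr_divide powr_diff field_simps)
  then show ?thesis
    unfolding J F_def by (simp add: ennreal_mult'[symmetric] ennreal_leI)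
next
  case False
  consider "(\<integral>x. f x \<partial>M) = 0" | "(\<integral>\<^sup>+x. f x powr p * \<gamma> x powr (1 - p) \<partial>M) = \<infinity>"
  proof -
    have "(\<integral>x. f x \<partial>M) \<ge> 0" using f by (intro integral_nonneg_AE AE_I2) auto
    with False that show ?thesis
      by (metis less_eq_real_def not_integrable_integral_eq top.not_eq_extremum infinity_ennreal_def)
  qed
  then show ?thesis
    using G by cases (auto simp: ennreal_mult_top)
qed

text \<open>Muckenhoupt-type argument: Jensen with weight \<gamma> on (a, x), then Tonelli. In the application
  \<gamma> is the derivative of a supersolution G.\<close>

lemma weighted_hardy_criterion:
  fixes f \<gamma> G u v :: "real \<Rightarrow> real" and a b p D :: real
  assumes p: "1 < p"
    and [measurable]: "f \<in> borel_measurable lebesgue" "\<gamma> \<in> borel_measurable borel"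
      "G \<in> borel_measurable borel" "u \<in> borel_measurable borel" "v \<in> borel_measurable borel"
    and f: "\<And>x. 0 \<le> f x"
    and \<gamma>: "\<And>x. x \<in> {a<..<b} \<Longrightarrow> 0 < \<gamma> x" and G: "\<And>x. x \<in> {a<..<b} \<Longrightarrow> 0 < G x"
    and u: "\<And>x. x \<in> {a<..<b} \<Longrightarrow> 0 \<le> u x" and v: "\<And>x. x \<in> {a<..<b} \<Longrightarrow> 0 \<le> v x"
    and D: "0 \<le> D"
    and \<gamma>_int: "\<And>x. x \<in> {a<..<b} \<Longrightarrow> (\<integral>\<^sup>+t. ennreal (\<gamma> t) * indicator {a<..<x} t \<partial>lborel) \<le> ennreal (G x)"
    and G_int: "\<And>t. t \<in> {a<..<b} \<Longrightarrow>
      (\<integral>\<^sup>+x. ennreal (G x powr (p - 1) * u x) * indicator {t<..<b} x \<partial>lborel)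
        \<le> ennreal (D * (v t * \<gamma> t powr (p - 1)))"
  shows "(\<integral>\<^sup>+x. ennreal ((LINT t:{a<..<x}|lebesgue. f t) powr p * u x) * indicator {a<..<b} x \<partial>lebesgue)
    \<le> ennreal D * (\<integral>\<^sup>+t. ennreal (f t powr p * v t) * indicator {a<..<b} t \<partial>lebesgue)"
proof -
  interpret sigma_finite_measure "lebesgue :: real measure"
    by (rule sigma_finite_completion) (rule sigma_finite_lborel)
  interpret pair_sigma_finite "lebesgue :: real measure" "lebesgue :: real measure" ..
  have [measurable]: "\<gamma> \<in> borel_measurable lebesgue" "G \<in> borel_measurable lebesgue"
    "u \<in> borel_measurable lebesgue" "v \<in> borel_measurable lebesgue"
    by (simp_all add: measurable_completion)
  have id[measurable]: "(\<lambda>x. x) \<in> borel_measurable (lebesgue :: real measure)"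
    by (rule measurable_completion) simp
  \<comment> \<open>The product sigma-algebra here is not completed, so measurability of the
    triangle t < x is derived from the coordinate maps.\<close>
  have "{x \<in> space (lebesgue \<Otimes>\<^sub>M lebesgue). fst x < (snd x :: real)}
      \<in> sets (lebesgue \<Otimes>\<^sub>M lebesgue)"
    by (intro borel_measurable_less measurable_compose[OF _ id]) simp_all
  then have [measurable]: "Measurable.pred (lebesgue \<Otimes>\<^sub>M lebesgue) (\<lambda>x. fst x < (snd x :: real))"
    by (simp add: pred_def)
  define H where "H x = ennreal (G x powr (p - 1) * u x)" for x
  define \<phi> where "\<phi> t = ennreal (f t powr p * \<gamma> t powr (1 - p))" for t
  define I where "I = (indicator {a<..<b} :: real \<Rightarrow> ennreal)"
  have [measurable]: "H \<in> borel_measurable lebesgue" "\<phi> \<in> borel_measurable lebesgue"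
    "I \<in> borel_measurable lebesgue"
    unfolding H_def \<phi>_def I_def by measurable
  \<comment> \<open>For each x the Hoelder bound is used on (a, x). Indicators turn the varying
    domain into a double integral over a fixed square, ready for Tonelli.\<close>
  have "(\<integral>\<^sup>+x. ennreal ((LINT t:{a<..<x}|lebesgue. f t) powr p * u x) * I x \<partial>lebesgue)
    \<le> (\<integral>\<^sup>+x. (\<integral>\<^sup>+t. H x * I x * (\<phi> t * I t * (if t < x then 1 else 0)) \<partial>lebesgue) \<partial>lebesgue)"
  proof (intro nn_integral_mono)
    fix x :: real
    show "ennreal ((LINT t:{a<..<x}|lebesgue. f t) powr p * u x) * I x
      \<le> (\<integral>\<^sup>+t. H x * I x * (\<phi> t * I t * (if t < x then 1 else 0)) \<partial>lebesgue)"
    proof (cases "x \<in> {a<..<b}")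
      case True
      define M where "M = restrict_space lebesgue {a<..<x}"
      have sub: "{a<..<x} \<subseteq> {a<..<b}" using True by auto
      have "ennreal ((\<integral>t. f t \<partial>M) powr p)
          \<le> ennreal (G x powr (p - 1)) * (\<integral>\<^sup>+t. f t powr p * \<gamma> t powr (1 - p) \<partial>M)"
      proof (rule integral_powr_le_weighted[OF p G[OF True]])
        show "f \<in> borel_measurable M" "\<gamma> \<in> borel_measurable M"
          unfolding M_def by (auto intro: measurable_restrict_space1)
        show "0 < \<gamma> t" if "t \<in> space M" for t
          using that sub \<gamma> by (auto simp: M_def space_restrict_space)
        show "(\<integral>\<^sup>+t. \<gamma> t \<partial>M) \<le> ennreal (G x)"
          using \<gamma>_int[OF True] by (simp add: M_def nn_integral_restrict_space nn_integral_completion)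
      qed (use f in auto)
      moreover have "(\<integral>t. f t \<partial>M) = (LINT t:{a<..<x}|lebesgue. f t)"
        by (simp add: M_def integral_restrict_space set_lebesgue_integral_def)
      moreover have "(\<integral>\<^sup>+t. f t powr p * \<gamma> t powr (1 - p) \<partial>M)
          = (\<integral>\<^sup>+t. \<phi> t * I t * (if t < x then 1 else 0) \<partial>lebesgue)"
        using True by (auto simp: M_def nn_integral_restrict_space \<phi>_def I_def indicator_def
            intro!: nn_integral_cong)
      ultimately have "ennreal ((LINT t:{a<..<x}|lebesgue. f t) powr p) * ennreal (u x)
          \<le> ennreal (G x powr (p - 1)) * (\<integral>\<^sup>+t. \<phi> t * I t * (if t < x then 1 else 0) \<partial>lebesgue) * ennreal (u x)"
        by (intro mult_right_mono) auto
      also have "\<dots> = (\<integral>\<^sup>+t. H x * I x * (\<phi> t * I t * (if t < x then 1 else 0)) \<partial>lebesgue)"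
        using True u[OF True]
        by (subst nn_integral_cmult) (auto simp: H_def I_def ennreal_mult mult_ac)
      finally show ?thesis
        using True u[OF True] by (simp add: I_def ennreal_mult)
    qed (simp add: I_def)
  qed
  also have "\<dots> = (\<integral>\<^sup>+t. (\<integral>\<^sup>+x. H x * I x * (\<phi> t * I t * (if t < x then 1 else 0)) \<partial>lebesgue) \<partial>lebesgue)"
    by (rule Fubini') measurable
  also have "\<dots> \<le> (\<integral>\<^sup>+t. ennreal D * (ennreal (f t powr p * v t) * I t) \<partial>lebesgue)"
  proof (intro nn_integral_mono)
    fix t :: real
    show "(\<integral>\<^sup>+x. H x * I x * (\<phi> t * I t * (if t < x then 1 else 0)) \<partial>lebesgue)
      \<le> ennreal D * (ennreal (f t powr p * v t) * I t)"
    proof (cases "t \<in> {a<..<b}")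
      case True
      have "(\<integral>\<^sup>+x. H x * I x * (\<phi> t * I t * (if t < x then 1 else 0)) \<partial>lebesgue)
          = (\<integral>\<^sup>+x. \<phi> t * (H x * indicator {t<..<b} x) \<partial>lebesgue)"
        using True by (intro nn_integral_cong) (auto simp: I_def indicator_def mult_ac)
      also have "\<dots> = \<phi> t * (\<integral>\<^sup>+x. H x * indicator {t<..<b} x \<partial>lebesgue)"
        by (intro nn_integral_cmult) measurable
      also have "\<dots> \<le> \<phi> t * ennreal (D * (v t * \<gamma> t powr (p - 1)))"
        using G_int[OF True] by (intro mult_left_mono) (auto simp: H_def nn_integral_completion)
      also have "\<dots> = ennreal (f t powr p * \<gamma> t powr (1 - p) * (D * (v t * \<gamma> t powr (p - 1))))"
        using v[OF True] D by (simp add: \<phi>_def ennreal_mult)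
      also have "f t powr p * \<gamma> t powr (1 - p) * (D * (v t * \<gamma> t powr (p - 1)))
          = D * (f t powr p * v t) * (\<gamma> t powr (1 - p) * \<gamma> t powr (p - 1))"
        by simp
      \<comment> \<open>The weight introduced by Hoelder cancels against the one in
        \<open>G_int\<close>; this is why that hypothesis carries
        \<open>\<gamma> t powr (p - 1)\<close>.\<close>
      also have "\<gamma> t powr (1 - p) * \<gamma> t powr (p - 1) = 1"
        using \<gamma>[OF True] by (simp flip: powr_add)
      finally show ?thesis
        using True v[OF True] D by (simp add: I_def ennreal_mult)
    qed (simp add: I_def)
  qed
  also have "\<dots> = ennreal D * (\<integral>\<^sup>+t. ennreal (f t powr p * v t) * I t \<partial>lebesgue)"
    by (intro nn_integral_cmult) measurable
  finally show ?thesis by (simp only: I_def)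
qed

section \<open>Upper bound: the cosine-modulated supersolution\<close>

text \<open>The criterion is applied with \<open>u x = x powr (\<epsilon> - p)\<close> and
  \<open>v x = x powr \<epsilon>\<close>. The bound on \<open>\<kappa>\<close> keeps the angle in
  [0, pi/2) on [a, b], so the cosine stays positive and the sine nonnegative.\<close>

lemma hardy_inequality_of_cos_weight:
  fixes a b p \<epsilon> \<kappa> k :: real
  assumes p: "2 \<le> p" and \<epsilon>: "\<epsilon> < p - 1" and ab: "0 < a" "a < b"
    and \<kappa>: "0 \<le> \<kappa>" "\<kappa> * ln (b / a) < pi / 2"
    and k_def: "k = (p - 1 - \<epsilon>) / p"
  shows "hardy_inequality a b p \<epsilon> (k powr (2 - p) / (k\<^sup>2 + \<kappa>\<^sup>2))"
proof -
  define D where "D = k powr (2 - p) / (k\<^sup>2 + \<kappa>\<^sup>2)"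
  have k: "k > 0" using p \<epsilon> by (simp add: k_def)
  have kp: "k * p = p - 1 - \<epsilon>" using p by (simp add: k_def)
  have kk: "k\<^sup>2 + \<kappa>\<^sup>2 > 0" using k by (simp add: add_pos_nonneg)
  have D: "0 \<le> D" by (simp add: D_def)
  define \<theta> where "\<theta> x = \<kappa> * ln (b / x)" for x
  \<comment> \<open>The exponent \<open>1 / (p - 1)\<close> makes \<open>G powr (p - 1)\<close>
    linear in the cosine, so that \<open>G powr (p - 1) * u\<close> has the elementary
    antiderivative \<open>\<Phi>\<close>. The function \<open>\<gamma>\<close> is the derivative of
    G.\<close>
  define G where "G x = x powr k * cos (\<theta> x) powr (1 / (p - 1))" for x
  define \<gamma> where "\<gamma> x = x powr (k - 1) * cos (\<theta> x) powr (1 / (p - 1))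
      * (k + \<kappa> / (p - 1) * (sin (\<theta> x) / cos (\<theta> x)))" for x
  define \<Phi> where "\<Phi> x = - (x powr (- k) * (k * cos (\<theta> x) + \<kappa> * sin (\<theta> x))) / (k\<^sup>2 + \<kappa>\<^sup>2)" for x
  have [measurable]: "\<theta> \<in> borel_measurable borel" "G \<in> borel_measurable borel"
    "\<gamma> \<in> borel_measurable borel"
    unfolding G_def \<gamma>_def \<theta>_def by measurable
  have \<theta>: "0 \<le> \<theta> x" "\<theta> x < pi / 2" if "x \<in> {a..b}" for x
  proof -
    have x: "0 < x" "a \<le> x" "x \<le> b" using that ab by auto
    show "0 \<le> \<theta> x" using x \<kappa> by (simp add: \<theta>_def)
    have "\<theta> x \<le> \<kappa> * ln (b / a)"
      unfolding \<theta>_def using x ab \<kappa> by (intro mult_left_mono) (auto simp: frac_le)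
    with \<kappa> show "\<theta> x < pi / 2" by simp
  qed
  have cos: "0 < cos (\<theta> x)" and sin: "0 \<le> sin (\<theta> x)" if "x \<in> {a..b}" for x
    using \<theta>[OF that] by (auto intro!: cos_gt_zero_pi sin_ge_zero)
  have \<gamma>: "0 < \<gamma> x" if "x \<in> {a..b}" for x
    using cos[OF that] sin[OF that] k p ab \<kappa> that unfolding \<gamma>_def
    by (intro mult_pos_pos add_pos_nonneg mult_nonneg_nonneg divide_nonneg_nonneg) auto
  have G: "0 < G x" if "x \<in> {a..b}" for x
    using cos[OF that] ab that by (auto simp: G_def)
  have d\<theta>: "(\<theta> has_real_derivative - \<kappa> / x) (at x)" if "x \<in> {a..b}" for x
    unfolding \<theta>_def using that ab by (auto intro!: derivative_eq_intros simp: field_simps)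
  have dG: "(G has_real_derivative \<gamma> x) (at x)" if x: "x \<in> {a..b}" for x
  proof -
    have x0: "x > 0" using x ab by auto
    have c': "((\<lambda>x. cos (\<theta> x)) has_real_derivative sin (\<theta> x) * (\<kappa> / x)) (at x)"
      using d\<theta>[OF x] by (auto intro!: derivative_eq_intros)
    have c_powr: "cos (\<theta> x) powr (1 / (p - 1) - of_nat 1) = cos (\<theta> x) powr (1 / (p - 1)) / cos (\<theta> x)"
      using cos[OF x] by (simp add: powr_diff)
    from DERIV_mult[OF has_real_derivative_powr[OF x0, of k]
        DERIV_fun_powr[OF c' cos[OF x], of "1 / (p - 1)"]]
    show ?thesis
      unfolding G_def c_powr
      by (rule DERIV_cong) (use cos[OF x] p x0 in \<open>simp add: \<gamma>_def powr_diff field_simps\<close>)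
  qed
  have d\<Phi>: "(\<Phi> has_real_derivative x powr (- k - 1) * cos (\<theta> x)) (at x)" if x: "x \<in> {a..b}" for x
  proof -
    have x0: "x > 0" using x ab by auto
    have "((\<lambda>x. k * cos (\<theta> x) + \<kappa> * sin (\<theta> x)) has_real_derivative
        (k * sin (\<theta> x) - \<kappa> * cos (\<theta> x)) * (\<kappa> / x)) (at x)"
      using d\<theta>[OF x] x0 by (auto intro!: derivative_eq_intros simp: field_simps)
    from DERIV_cdivide[OF DERIV_minus[OF DERIV_mult[OF has_real_derivative_powr[OF x0, of "- k"] this]]]
    show ?thesis
      unfolding \<Phi>_def
    proof (rule DERIV_cong)
      have "- (- k * x powr (- k - 1) * (k * cos (\<theta> x) + \<kappa> * sin (\<theta> x)) +
          (k * sin (\<theta> x) - \<kappa> * cos (\<theta> x)) * (\<kappa> / x) * x powr - k)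
          = x powr (- k - 1) * cos (\<theta> x) * (k\<^sup>2 + \<kappa>\<^sup>2)"
        using x0 by (simp add: powr_diff field_simps power2_eq_square)
      then show "- (- k * x powr (- k - 1) * (k * cos (\<theta> x) + \<kappa> * sin (\<theta> x)) +
          (k * sin (\<theta> x) - \<kappa> * cos (\<theta> x)) * (\<kappa> / x) * x powr - k) / (k\<^sup>2 + \<kappa>\<^sup>2)
          = x powr (- k - 1) * cos (\<theta> x)"
        by (simp only: nonzero_mult_div_cancel_right[OF less_imp_neq[OF kk, THEN not_sym]])
    qed
  qed
  have \<gamma>_int: "(\<integral>\<^sup>+t. ennreal (\<gamma> t) * indicator {a<..<x} t \<partial>lborel) \<le> ennreal (G x)"
    if x: "x \<in> {a<..<b}" for x
  proof -
    have "(\<integral>\<^sup>+t. ennreal (\<gamma> t) * indicator {a<..<x} t \<partial>lborel)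
        \<le> (\<integral>\<^sup>+t. ennreal (\<gamma> t) * indicator {a..x} t \<partial>lborel)"
      by (intro nn_integral_mono) (auto simp: indicator_def)
    also have "\<dots> = ennreal (G x - G a)"
      using x by (intro nn_integral_FTC_Icc) (auto intro!: dG intro: less_imp_le[OF \<gamma>])
    also have "\<dots> \<le> ennreal (G x)"
      using G[of a] ab by (intro ennreal_leI) auto
    finally show ?thesis .
  qed
  have G_int: "(\<integral>\<^sup>+x. ennreal (G x powr (p - 1) * x powr (\<epsilon> - p)) * indicator {t<..<b} x \<partial>lborel)
        \<le> ennreal (D * (t powr \<epsilon> * \<gamma> t powr (p - 1)))" if t: "t \<in> {a<..<b}" for t
  proof -
    have t0: "t > 0" and tab: "t \<in> {a..b}" using t ab by auto
    have "(\<integral>\<^sup>+x. ennreal (G x powr (p - 1) * x powr (\<epsilon> - p)) * indicator {t<..<b} x \<partial>lborel)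
        \<le> (\<integral>\<^sup>+x. ennreal (x powr (- k - 1) * cos (\<theta> x)) * indicator {t..b} x \<partial>lborel)"
    proof (intro nn_integral_mono)
      fix x
      show "ennreal (G x powr (p - 1) * x powr (\<epsilon> - p)) * indicator {t<..<b} x
        \<le> ennreal (x powr (- k - 1) * cos (\<theta> x)) * indicator {t..b} x"
      proof (cases "x \<in> {t<..<b}")
        case True
        then have x: "x \<in> {a..b}" "x > 0" using t ab by auto
        \<comment> \<open>The choice of k as the critical exponent,
          \<open>k * p = p - 1 - \<epsilon>\<close>, reduces all powers of x to this one.\<close>
        have "\<epsilon> - p + k * (p - 1) = - k - 1"
          using kp by (simp add: algebra_simps)
        then have "G x powr (p - 1) * x powr (\<epsilon> - p) = x powr (- k - 1) * cos (\<theta> x)"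
          using p cos[OF x(1)] x by (simp add: G_def powr_mult powr_powr mult_ac flip: powr_add)
        then show ?thesis using True by simp
      qed simp
    qed
    also have "\<dots> = ennreal (\<Phi> b - \<Phi> t)"
      using t by (intro nn_integral_FTC_Icc) (auto intro!: d\<Phi> mult_nonneg_nonneg intro: less_imp_le[OF cos])
    \<comment> \<open>At b the sine and cosine are nonnegative, so the endpoint term has a
      favourable sign and is dropped.\<close>
    also have "\<Phi> b - \<Phi> t \<le> - \<Phi> t"
      using cos[of b] sin[of b] ab k \<kappa> kk by (simp add: \<Phi>_def)
    also have "- \<Phi> t \<le> D * (t powr \<epsilon> * \<gamma> t powr (p - 1))"
    proof -
      \<comment> \<open>With this rescaled tangent, both sides share the factor \<open>t powr (- k)
        * cos (\<theta> t) * k / (k\<^sup>2 + \<kappa>\<^sup>2)\<close>. What remains is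
        \<open>1 + y \<le> (1 + y / (p - 1)) powr (p - 1)\<close>, Bernoulli with exponent
        \<open>p - 1\<close>, which is at least 1 because p >= 2.\<close>
      define y where "y = \<kappa> / k * (sin (\<theta> t) / cos (\<theta> t))"
      have y: "y \<ge> 0" using sin[OF tab] cos[OF tab] \<kappa> k by (simp add: y_def)
      have "\<gamma> t = t powr (k - 1) * cos (\<theta> t) powr (1 / (p - 1)) * (k * (1 + y / (p - 1)))"
      proof -
        have "k * y = \<kappa> * (sin (\<theta> t) / cos (\<theta> t))" using k by (simp add: y_def)
        then have "k * (1 + y / (p - 1)) = k + \<kappa> / (p - 1) * (sin (\<theta> t) / cos (\<theta> t))"
          by (simp add: distrib_left)
        then show ?thesis by (simp only: \<gamma>_def)
      qed
      then have "\<gamma> t powr (p - 1) = t powr ((k - 1) * (p - 1)) * cos (\<theta> t)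
          * (k powr (p - 1) * (1 + y / (p - 1)) powr (p - 1))"
        using cos[OF tab] t0 k y p by (simp add: powr_mult powr_powr)
      moreover have "\<epsilon> + (k - 1) * (p - 1) = - k" using kp by (simp add: algebra_simps)
      ultimately have "t powr \<epsilon> * \<gamma> t powr (p - 1)
          = t powr (- k) * cos (\<theta> t) * k powr (p - 1) * (1 + y / (p - 1)) powr (p - 1)"
        by (simp add: mult.assoc[symmetric] flip: powr_add)
      then have "D * (t powr \<epsilon> * \<gamma> t powr (p - 1))
          = t powr (- k) * cos (\<theta> t) * (D * k powr (p - 1)) * (1 + y / (p - 1)) powr (p - 1)"
        by simp
      also have "D * k powr (p - 1) = k / (k\<^sup>2 + \<kappa>\<^sup>2)"
        using k by (simp add: D_def flip: powr_add)
      finally have eq: "D * (t powr \<epsilon> * \<gamma> t powr (p - 1))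
          = t powr (- k) * cos (\<theta> t) * k / (k\<^sup>2 + \<kappa>\<^sup>2) * (1 + y / (p - 1)) powr (p - 1)"
        by simp
      have "1 + (p - 1) * (y / (p - 1)) \<le> (1 + y / (p - 1)) powr (p - 1)"
        using y p by (intro one_plus_powr_ge) auto
      then have "1 + y \<le> (1 + y / (p - 1)) powr (p - 1)" using p by simp
      then have "t powr (- k) * cos (\<theta> t) * k / (k\<^sup>2 + \<kappa>\<^sup>2) * (1 + y)
          \<le> D * (t powr \<epsilon> * \<gamma> t powr (p - 1))"
        unfolding eq using k kk cos[OF tab] by (intro mult_left_mono) auto
      moreover have "t powr (- k) * cos (\<theta> t) * k / (k\<^sup>2 + \<kappa>\<^sup>2) * (1 + y) = - \<Phi> t"
      proof -
        have "cos (\<theta> t) * k * (1 + y) = k * cos (\<theta> t) + \<kappa> * sin (\<theta> t)"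
          using k cos[OF tab] by (simp add: y_def field_simps)
        then have "t powr (- k) * (cos (\<theta> t) * k * (1 + y)) / (k\<^sup>2 + \<kappa>\<^sup>2) = - \<Phi> t"
          by (simp add: \<Phi>_def)
        then show ?thesis by simp
      qed
      ultimately show ?thesis by simp
    qed
    finally show ?thesis by (simp add: ennreal_leI)
  qed
  show ?thesis
    unfolding hardy_inequality_def D_def[symmetric]
  proof (intro allI impI)
    fix f assume "hardy_admissible a b p \<epsilon> f"
    then have meas: "set_borel_measurable lebesgue {a<..<b} f" and f: "\<And>x. x \<in> {a<..<b} \<Longrightarrow> 0 \<le> f x"
      and int: "set_integrable lebesgue {a<..<b} (\<lambda>x. f x powr p * x powr \<epsilon>)"
      by (auto simp: hardy_admissible_def)
    \<comment> \<open>Admissibility constrains f only on (a, b), while the criterion asks for a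
      measurable nonnegative function on the whole line; hence the extension by zero.\<close>
    define g where "g x = indicator {a<..<b} x * f x" for x
    have [measurable]: "g \<in> borel_measurable lebesgue"
      using meas by (simp add: set_borel_measurable_def g_def[abs_def])
    have g: "0 \<le> g x" for x using f by (simp add: g_def indicator_def)
    have eqf: "(LINT t:{a<..<x}|lebesgue. f t) = (LINT t:{a<..<x}|lebesgue. g t)" if "x \<in> {a<..<b}" for x
      using that by (intro set_lebesgue_integral_cong) (auto simp: g_def)
    define R where "R = (LINT x:{a<..<b}|lebesgue. f x powr p * x powr \<epsilon>)"
    have R: "R \<ge> 0" unfolding R_def set_lebesgue_integral_def
      by (intro integral_nonneg_AE AE_I2) (auto simp: indicator_def)
    have nnR: "(\<integral>\<^sup>+t. ennreal (g t powr p * t powr \<epsilon>) * indicator {a<..<b} t \<partial>lebesgue) = ennreal R"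
    proof -
      have "(\<integral>\<^sup>+t. ennreal (g t powr p * t powr \<epsilon>) * indicator {a<..<b} t \<partial>lebesgue)
          = (\<integral>\<^sup>+t. ennreal (indicator {a<..<b} t *\<^sub>R (f t powr p * t powr \<epsilon>)) \<partial>lebesgue)"
        by (intro nn_integral_cong) (auto simp: g_def indicator_def)
      also have "\<dots> = ennreal R"
        unfolding R_def set_lebesgue_integral_def
        by (intro nn_integral_eq_integral int[unfolded set_integrable_def] AE_I2)
          (auto simp: indicator_def)
      finally show ?thesis .
    qed
    define l where "l x = ((1 / x) * (LINT t:{a<..<x}|lebesgue. f t)) powr p * x powr \<epsilon>" for x
    have l: "l x \<ge> 0" for x by (simp add: l_def)
    show "(LINT x:{a<..<b}|lebesgue. l x) \<le> D * R"
    proof (cases "set_integrable lebesgue {a<..<b} l")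
      case True
      have "ennreal (LINT x:{a<..<b}|lebesgue. l x)
          = (\<integral>\<^sup>+x. ennreal (indicator {a<..<b} x *\<^sub>R l x) \<partial>lebesgue)"
        unfolding set_lebesgue_integral_def using l
        by (intro nn_integral_eq_integral[symmetric] True[unfolded set_integrable_def] AE_I2) simp
      also have "\<dots> = (\<integral>\<^sup>+x. ennreal ((LINT t:{a<..<x}|lebesgue. g t) powr p * x powr (\<epsilon> - p))
          * indicator {a<..<b} x \<partial>lebesgue)"
      proof (intro nn_integral_cong)
        fix x
        show "ennreal (indicator {a<..<b} x *\<^sub>R l x) =
            ennreal ((LINT t:{a<..<x}|lebesgue. g t) powr p * x powr (\<epsilon> - p)) * indicator {a<..<b} x"
        proof (cases "x \<in> {a<..<b}")
          case True
          have "(LINT t:{a<..<x}|lebesgue. g t) \<ge> 0"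
            unfolding set_lebesgue_integral_def using g by (intro integral_nonneg_AE AE_I2) auto
          then have "l x = (LINT t:{a<..<x}|lebesgue. g t) powr p * x powr (\<epsilon> - p)"
            using True ab by (simp add: l_def eqf powr_mult powr_divide powr_diff)
          then show ?thesis using True by simp
        qed simp
      qed
      also have "\<dots> \<le> ennreal D * (\<integral>\<^sup>+t. ennreal (g t powr p * t powr \<epsilon>) * indicator {a<..<b} t \<partial>lebesgue)"
        using p g D \<gamma> G \<gamma>_int G_int
        by (intro weighted_hardy_criterion[where \<gamma> = \<gamma> and G = G]) auto
      also have "\<dots> = ennreal (D * R)"
        unfolding nnR using D R by (simp add: ennreal_mult)
      finally show ?thesis using D R by (simp add: ennreal_le_iff)
    next
      \<comment> \<open>A non-integrable left-hand integrand has Bochner integral 0, and the right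
        side is nonnegative.\<close>
      case False
      then have "(LINT x:{a<..<b}|lebesgue. l x) = 0"
        by (simp add: set_lebesgue_integral_def set_integrable_def not_integrable_integral_eq)
      then show ?thesis using D R by simp
    qed
  qed
qed

section \<open>Lower bound: a truncated sine test function\<close>

text \<open>The test function is continuous on [a, b]; this passes from the integrals in
  \<open>hardy_inequality\<close> to gauge integrals, where the fundamental theorem of calculus is
  available.\<close>

lemma
  fixes h :: "real \<Rightarrow> real"
  assumes "continuous_on {c..d} h"
  shows set_integrable_lebesgue_Ioo: "set_integrable lebesgue {c<..<d} h"
    and set_lebesgue_integral_Ioo: "(LINT x:{c<..<d}|lebesgue. h x) = integral {c..d} h"
proof -
  have i: "set_integrable lborel {c<..<d} h"
    by (rule set_integrable_subset[OF borel_integrable_atLeastAtMost'[OF assms]]) auto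
  then show "set_integrable lebesgue {c<..<d} h"
    by (simp add: set_integrable_def integrable_completion borel_measurable_integrable)
  have "(LINT x:{c<..<d}|lebesgue. h x) = (LINT x:{c<..<d}|lborel. h x)"
    using i unfolding set_lebesgue_integral_def set_integrable_def
    by (intro integral_completion) (rule borel_measurable_integrable)
  also have "\<dots> = integral {c..d} h"
    using set_borel_integral_eq_integral(2)[OF i] by (simp add: integral_open_interval_real)
  finally show "(LINT x:{c<..<d}|lebesgue. h x) = integral {c..d} h" .
qed

text \<open>On the logarithmic scale all powers of x reduce to dx/x. The left side is then at least
  the integral I of the p-th power of the sine over one half period, divided by
  \<open>\<nu>\<close>. The right side is at most \<open>d * A powr p * I\<close>, where
  \<open>A = sqrt (k\<^sup>2 + \<nu>\<^sup>2)\<close> is the amplitude of the derivative. Cancelling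
  I gives the bound.\<close>

lemma hardy_inequality_lower_bound:
  fixes a b p \<epsilon> k \<nu> d :: real
  assumes p: "2 \<le> p" and \<epsilon>: "\<epsilon> < p - 1" and ab: "0 < a" "a < b"
    and k_def: "k = (p - 1 - \<epsilon>) / p" and \<nu>_def: "\<nu> = pi / ln (b / a)"
    and hardy: "hardy_inequality a b p \<epsilon> d"
  shows "(k\<^sup>2 + \<nu>\<^sup>2) powr (- (p / 2)) \<le> d"
proof -
  have k: "k > 0" using p \<epsilon> by (simp add: k_def)
  have kp: "k * p = p - 1 - \<epsilon>" using p by (simp add: k_def)
  have ln: "ln (b / a) > 0" using ab by simp
  have \<nu>: "\<nu> > 0" using ln by (simp add: \<nu>_def)
  define A where "A = sqrt (k\<^sup>2 + \<nu>\<^sup>2)"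
  have A: "A > 0" using k by (simp add: A_def add_pos_nonneg)
  \<comment> \<open>A and \<open>\<phi>\<close> are the polar coordinates of the point
    \<open>(k, \<nu>)\<close>, so that \<open>k * sin + \<nu> * cos\<close> becomes A times a sine
    shifted by \<open>\<phi>\<close>.\<close>
  define \<phi> where "\<phi> = arctan (\<nu> / k)"
  have \<phi>: "0 \<le> \<phi>" "\<phi> < pi"
    using k \<nu> arctan_ubound[of "\<nu> / k"] pi_gt_zero
    unfolding \<phi>_def by (simp, linarith)
  have A_cos: "A * cos \<phi> = k" and A_sin: "A * sin \<phi> = \<nu>"
  proof -
    have "sqrt (1 + (\<nu> / k)\<^sup>2) = A / k"
    proof -
      have "1 + (\<nu> / k)\<^sup>2 = (k\<^sup>2 + \<nu>\<^sup>2) / k\<^sup>2" using k by (simp add: field_simps)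
      then show ?thesis using k by (simp add: A_def real_sqrt_divide)
    qed
    then show "A * cos \<phi> = k" "A * sin \<phi> = \<nu>"
      using k A by (simp_all add: \<phi>_def cos_arctan sin_arctan)
  qed
  define \<theta> where "\<theta> x = \<nu> * ln (x / a)" for x
  have \<theta>a: "\<theta> a = 0" and \<theta>b: "\<theta> b = pi" using ab ln by (simp_all add: \<theta>_def \<nu>_def)
  have \<theta>: "0 \<le> \<theta> x" "\<theta> x \<le> pi" if "x \<in> {a..b}" for x
  proof -
    have x: "0 < x" "a \<le> x" "x \<le> b" using that ab by auto
    show "0 \<le> \<theta> x" using x ab \<nu> by (simp add: \<theta>_def)
    have "\<theta> x \<le> \<nu> * ln (b / a)"
      unfolding \<theta>_def using x ab \<nu> by (intro mult_left_mono) (auto simp: divide_right_mono)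
    then show "\<theta> x \<le> pi" using ln by (simp add: \<nu>_def)
  qed
  have d\<theta>: "(\<theta> has_real_derivative \<nu> / x) (at x)" if "x \<in> {a..b}" for x
    unfolding \<theta>_def using that ab by (auto intro!: derivative_eq_intros simp: field_simps)
  have cont\<theta>: "continuous_on {a..b} \<theta>"
    by (rule DERIV_continuous_on[OF has_field_derivative_at_within[OF d\<theta>]])
  define f0 where "f0 x = x powr (k - 1) * (A * sin (\<theta> x + \<phi>))" for x
  \<comment> \<open>The derivative \<open>f0\<close> of G turns negative near b; truncation gives an
    admissible f, and \<open>f \<ge> f0\<close> makes its primitive F dominate G.\<close>
  define f where "f x = x powr (k - 1) * (A * max 0 (sin (\<theta> x + \<phi>)))" for x
  define G where "G x = x powr k * sin (\<theta> x)" for x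
  have dG: "(G has_real_derivative f0 x) (at x)" if x: "x \<in> {a..b}" for x
  proof -
    have x0: "x > 0" using x ab by auto
    have "((\<lambda>x. sin (\<theta> x)) has_real_derivative cos (\<theta> x) * (\<nu> / x)) (at x)"
      using d\<theta>[OF x] by (auto intro!: derivative_eq_intros)
    from DERIV_mult[OF has_real_derivative_powr[OF x0, of k] this]
    show ?thesis
      unfolding G_def
    proof (rule DERIV_cong)
      have "A * sin (\<theta> x + \<phi>) = k * sin (\<theta> x) + \<nu> * cos (\<theta> x)"
        unfolding sin_add A_cos[symmetric] A_sin[symmetric] by (simp add: algebra_simps)
      then show "k * x powr (k - 1) * sin (\<theta> x) + cos (\<theta> x) * (\<nu> / x) * x powr k = f0 x"
        using x0 by (simp add: f0_def powr_diff field_simps)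
    qed
  qed
  have contf: "continuous_on {a..b} f" and contf0: "continuous_on {a..b} f0"
    unfolding f_def f0_def using ab by (auto intro!: continuous_intros cont\<theta>)
  have f: "f x \<ge> 0" for x using A by (simp add: f_def)
  define F where "F x = integral {a..x} f" for x
  have contF: "continuous_on {a..b} F"
    unfolding F_def using contf by (intro indefinite_integral_continuous_1 integrable_continuous_real)
  have F: "G x \<le> F x" if x: "x \<in> {a..b}" for x
  proof -
    have sub: "{a..x} \<subseteq> {a..b}" using x by auto
    have "(f0 has_integral (G x - G a)) {a..x}"
      using x by (intro fundamental_theorem_of_calculus)
        (auto simp flip: has_real_derivative_iff_has_vector_derivative
          intro!: has_field_derivative_at_within dG)
    then have "G x = integral {a..x} f0" by (simp add: G_def \<theta>a integral_unique)
    also have "\<dots> \<le> F x"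
      unfolding F_def using A continuous_on_subset[OF contf sub] continuous_on_subset[OF contf0 sub]
      by (intro integral_le integrable_continuous_real) (auto simp: f_def f0_def mult_left_mono)
    finally show ?thesis .
  qed
  define S where "S u = (max 0 (sin u)) powr p" for u :: real
  have S: "S u \<ge> 0" for u by (simp add: S_def)
  have contS: "continuous_on X S" for X
    unfolding S_def using p by (intro continuous_on_powr') (auto intro!: continuous_intros)
  define \<Psi> where "\<Psi> y = integral {0..y} S" for y
  have \<Psi>': "(\<Psi> has_real_derivative S y) (at y within {0..2 * pi})" if "y \<in> {0..2 * pi}" for y
    unfolding \<Psi>_def using that by (intro integral_has_real_derivative contS)
  \<comment> \<open>Substitution of \<open>\<theta> x + c\<close>, which runs over [c, pi + c]
    inside [0, 2 pi]. It is used with c = 0 for the left side and with \<open>c = \<phi>\<close> for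
    the right side.\<close>
  have S_int: "((\<lambda>x. S (\<theta> x + c) / x) has_integral (\<Psi> (pi + c) - \<Psi> c) / \<nu>) {a..b}"
    if c: "0 \<le> c" "c < pi" for c
  proof -
    have "((\<lambda>x. \<Psi> (\<theta> x + c) / \<nu>) has_real_derivative S (\<theta> x + c) / x) (at x within {a..b})"
      if x: "x \<in> {a..b}" for x
    proof -
      have "((\<lambda>x. \<theta> x + c) has_real_derivative \<nu> / x) (at x within {a..b})"
        using DERIV_add[OF has_field_derivative_at_within[OF d\<theta>[OF x]] DERIV_const[of c]] by simp
      moreover have "(\<Psi> has_real_derivative S (\<theta> x + c)) (at (\<theta> x + c) within (\<lambda>x. \<theta> x + c) ` {a..b})"
      proof (rule DERIV_subset[OF \<Psi>'])
        show "\<theta> x + c \<in> {0..2 * pi}" using \<theta>[OF x] c by auto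
        show "(\<lambda>x. \<theta> x + c) ` {a..b} \<subseteq> {0..2 * pi}" using \<theta> c by fastforce
      qed
      ultimately have "((\<lambda>x. \<Psi> (\<theta> x + c)) has_real_derivative S (\<theta> x + c) * (\<nu> / x)) (at x within {a..b})"
        by (rule DERIV_image_chain[of \<Psi> _ "\<lambda>x. \<theta> x + c", unfolded o_def, rotated])
      from DERIV_cdivide[OF this, of \<nu>] show ?thesis using \<nu> by simp
    qed
    then have "((\<lambda>x. S (\<theta> x + c) / x) has_integral (\<Psi> (\<theta> b + c) / \<nu> - \<Psi> (\<theta> a + c) / \<nu>)) {a..b}"
      using ab by (intro fundamental_theorem_of_calculus)
        (auto simp flip: has_real_derivative_iff_has_vector_derivative)
    then show ?thesis by (simp add: \<theta>a \<theta>b diff_divide_distrib)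
  qed
  define I where "I = \<Psi> pi / \<nu>"
  have "\<Psi> pi > 0"
  proof -
    have "\<Psi> pi \<noteq> 0"
    proof
      assume "\<Psi> pi = 0"
      then have "\<forall>x\<in>{0..pi}. S x = 0"
        unfolding \<Psi>_def using S by (subst (asm) integral_eq_0_iff[OF contS]) auto
      then have "S (pi / 2) = 0" by simp
      then show False by (simp add: S_def)
    qed
    moreover have "\<Psi> pi \<ge> 0"
      unfolding \<Psi>_def using S by (intro integral_nonneg integrable_continuous_real contS)
    ultimately show ?thesis by simp
  qed
  then have I: "I > 0" using \<nu> by (simp add: I_def)
  have cont: "continuous_on {a..b} (\<lambda>x. f x powr p * x powr \<epsilon>)"
    using contf p f ab by (intro continuous_on_mult continuous_on_powr' continuous_intros) auto
  have adm: "hardy_admissible a b p \<epsilon> f"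
    using set_integrable_lebesgue_Ioo[OF contf] set_integrable_lebesgue_Ioo[OF cont] f
    by (auto simp: hardy_admissible_def set_borel_measurable_def set_integrable_def
        dest: borel_measurable_integrable)
  have R: "(LINT x:{a<..<b}|lebesgue. f x powr p * x powr \<epsilon>) \<le> A powr p * I"
  proof -
    have "(LINT x:{a<..<b}|lebesgue. f x powr p * x powr \<epsilon>)
        = integral {a..b} (\<lambda>x. f x powr p * x powr \<epsilon>)"
      by (rule set_lebesgue_integral_Ioo[OF cont])
    also have "\<dots> = integral {a..b} (\<lambda>x. A powr p * (S (\<theta> x + \<phi>) / x))"
    proof (rule integral_cong)
      fix x assume x: "x \<in> {a..b}"
      then have x0: "x > 0" using ab by auto
      have "(k - 1) * p + \<epsilon> = - 1" using kp by (simp add: algebra_simps)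
      then have "x powr ((k - 1) * p) * x powr \<epsilon> = 1 / x"
        using x0 by (simp add: powr_minus_divide flip: powr_add)
      moreover have "f x powr p * x powr \<epsilon>
          = x powr ((k - 1) * p) * x powr \<epsilon> * (A powr p * S (\<theta> x + \<phi>))"
        using x0 A by (simp add: f_def S_def powr_mult powr_powr)
      ultimately show "f x powr p * x powr \<epsilon> = A powr p * (S (\<theta> x + \<phi>) / x)" by simp
    qed
    also have "\<dots> = A powr p * ((\<Psi> (pi + \<phi>) - \<Psi> \<phi>) / \<nu>)"
      by (rule integral_unique[OF has_integral_mult_right[OF S_int[OF \<phi>]]])
    also have "(\<Psi> (pi + \<phi>) - \<Psi> \<phi>) / \<nu> \<le> I"
    proof -
      \<comment> \<open>Beyond pi the sine is nonpositive and S vanishes, so the shifted arc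
        contributes only over the part from \<open>\<phi>\<close> to pi of the original half
        period.\<close>
      have "\<Psi> (pi + \<phi>) = \<Psi> pi + integral {pi..pi + \<phi>} S"
        unfolding \<Psi>_def using \<phi> pi_gt_zero
        by (intro Henstock_Kurzweil_Integration.integral_combine[symmetric] integrable_continuous_real contS) auto
      also have "integral {pi..pi + \<phi>} S = integral {pi..pi + \<phi>} (\<lambda>_. 0)"
      proof (rule integral_cong)
        fix u assume "u \<in> {pi..pi + \<phi>}"
        then have "sin u \<le> 0" using \<phi> by (intro sin_le_zero) auto
        then show "S u = 0" by (simp add: S_def)
      qed
      finally have "\<Psi> (pi + \<phi>) = \<Psi> pi" by simp
      moreover have "\<Psi> \<phi> \<ge> 0"
        unfolding \<Psi>_def using S by (intro integral_nonneg integrable_continuous_real contS)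
      ultimately show ?thesis using \<nu> by (simp add: I_def divide_right_mono)
    qed
    finally show ?thesis using A by (simp add: mult_left_mono)
  qed
  have L: "I \<le> (LINT x:{a<..<b}|lebesgue. ((1 / x) * (LINT t:{a<..<x}|lebesgue. f t)) powr p * x powr \<epsilon>)"
  proof -
    have F0: "F x \<ge> 0" if "x \<in> {a..b}" for x
      unfolding F_def using f contf that
      by (intro integral_nonneg integrable_continuous_real) (auto intro: continuous_on_subset)
    have cont: "continuous_on {a..b} (\<lambda>x. ((1 / x) * F x) powr p * x powr \<epsilon>)"
      using contF p F0 ab by (intro continuous_on_mult continuous_on_powr' continuous_intros) auto
    have "I = integral {a..b} (\<lambda>x. S (\<theta> x) / x)"
      using S_int[of 0] by (simp add: I_def integral_unique \<Psi>_def)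
    also have "\<dots> \<le> integral {a..b} (\<lambda>x. ((1 / x) * F x) powr p * x powr \<epsilon>)"
    proof (rule integral_le)
      show "(\<lambda>x. S (\<theta> x) / x) integrable_on {a..b}"
        using S_int[of 0] by (auto intro: has_integral_integrable)
      show "(\<lambda>x. ((1 / x) * F x) powr p * x powr \<epsilon>) integrable_on {a..b}"
        by (rule integrable_continuous_real[OF cont])
      fix x assume x: "x \<in> {a..b}"
      then have x0: "x > 0" using ab by auto
      have sin: "sin (\<theta> x) \<ge> 0" using \<theta>[OF x] by (intro sin_ge_zero) auto
      have "k * p + - p + \<epsilon> = - 1" using kp by simp
      then have "x powr (k * p) * x powr (- p) * x powr \<epsilon> = x powr (- 1)"
        by (simp only: powr_add[symmetric])
      also have "x powr (- 1) = 1 / x" using x0 by (simp add: powr_minus_divide)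
      finally have "x powr (k * p) * x powr (- p) * x powr \<epsilon> = 1 / x" .
      moreover have "((1 / x) * G x) powr p * x powr \<epsilon>
          = x powr (k * p) * x powr (- p) * x powr \<epsilon> * S (\<theta> x)"
        using x0 sin by (simp add: G_def S_def powr_mult powr_divide powr_powr powr_minus divide_inverse inverse_powr)
      ultimately have "S (\<theta> x) / x = ((1 / x) * G x) powr p * x powr \<epsilon>" by simp
      also have "\<dots> \<le> ((1 / x) * F x) powr p * x powr \<epsilon>"
        using F[OF x] x0 sin p
        by (intro mult_right_mono powr_mono2) (auto simp: divide_right_mono G_def)
      finally show "S (\<theta> x) / x \<le> ((1 / x) * F x) powr p * x powr \<epsilon>" .
    qed
    also have "\<dots> = (LINT x:{a<..<b}|lebesgue. ((1 / x) * F x) powr p * x powr \<epsilon>)"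
      by (rule set_lebesgue_integral_Ioo[OF cont, symmetric])
    also have "\<dots> = (LINT x:{a<..<b}|lebesgue. ((1 / x) * (LINT t:{a<..<x}|lebesgue. f t)) powr p * x powr \<epsilon>)"
    proof (intro set_lebesgue_integral_cong allI impI)
      fix x assume "x \<in> {a<..<b}"
      then have "continuous_on {a..x} f" by (intro continuous_on_subset[OF contf]) auto
      from set_lebesgue_integral_Ioo[OF this]
      show "((1 / x) * F x) powr p * x powr \<epsilon>
          = ((1 / x) * (LINT t:{a<..<x}|lebesgue. f t)) powr p * x powr \<epsilon>"
        by (simp add: F_def)
    qed simp
    finally show ?thesis .
  qed
  define R' where "R' = (LINT x:{a<..<b}|lebesgue. f x powr p * x powr \<epsilon>)"
  have "I \<le> d * R'"
    using L hardy adm unfolding hardy_inequality_def R'_def by (meson order_trans)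
  moreover have R': "R' \<ge> 0" unfolding R'_def set_lebesgue_integral_def
    by (intro integral_nonneg_AE AE_I2) (auto simp: indicator_def)
  \<comment> \<open>Positivity of d is what allows R' to be replaced by its upper bound
    \<open>A powr p * I\<close> in the next step.\<close>
  ultimately have d: "d > 0" using I by (smt (verit) mult_nonneg_nonneg mult_nonpos_nonneg)
  have "I \<le> d * (A powr p * I)"
    using \<open>I \<le> d * R'\<close> R d unfolding R'_def[symmetric] by (smt (verit) mult_left_mono)
  then have "1 \<le> d * A powr p" using I by simp
  then have "A powr (- p) \<le> d" using A by (simp add: powr_minus_divide field_simps)
  moreover have "A powr (- p) = (k\<^sup>2 + \<nu>\<^sup>2) powr (- (p / 2))"
    unfolding A_def by (simp add: powr_half_sqrt[symmetric] powr_powr)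
  ultimately show ?thesis by simp
qed

section \<open>Existence of the least constant\<close>

text \<open>\<open>LEAST\<close> on the reals says something only when a minimum exists. The valid
  constants are nonempty and bounded below by hypothesis, and for each fixed f the condition is a
  non-strict inequality linear in d, so it survives passage to the infimum.\<close>

lemma hardy_inequality_hardy_const:
  assumes ex: "hardy_inequality a b p \<epsilon> d\<^sub>0"
    and lb: "\<And>d. hardy_inequality a b p \<epsilon> d \<Longrightarrow> c \<le> d"
  shows "hardy_inequality a b p \<epsilon> (hardy_const a b p \<epsilon>)"
    and "hardy_inequality a b p \<epsilon> d \<Longrightarrow> hardy_const a b p \<epsilon> \<le> d"
proof -
  define X where "X = Collect (hardy_inequality a b p \<epsilon>)"
  have ne: "X \<noteq> {}" and bdd: "bdd_below X" using ex lb by (auto simp: X_def bdd_below_def)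
  have Inf: "hardy_inequality a b p \<epsilon> (Inf X)"
    unfolding hardy_inequality_def
  proof (intro allI impI)
    fix f assume f: "hardy_admissible a b p \<epsilon> f"
    define L where "L = (LINT x:{a<..<b}|lebesgue. ((1 / x) * (LINT t:{a<..<x}|lebesgue. f t)) powr p * x powr \<epsilon>)"
    define R where "R = (LINT x:{a<..<b}|lebesgue. f x powr p * x powr \<epsilon>)"
    have le: "L \<le> d * R" if "d \<in> X" for d
      using that f by (auto simp: X_def hardy_inequality_def L_def R_def)
    have "R \<ge> 0" unfolding R_def set_lebesgue_integral_def
      by (intro integral_nonneg_AE AE_I2) (auto simp: indicator_def)
    then consider "R = 0" | "R > 0" by linarith
    then have "L \<le> Inf X * R"
    proof cases
      case 1
      then show ?thesis using ne le by fastforce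
    next
      case 2
      then have "L / R \<le> Inf X" using ne le by (intro cInf_greatest) (auto simp: field_simps)
      with 2 show ?thesis by (simp add: field_simps)
    qed
    then show "(LINT x:{a<..<b}|lebesgue. ((1 / x) * (LINT t:{a<..<x}|lebesgue. f t)) powr p * x powr \<epsilon>)
        \<le> Inf X * (LINT x:{a<..<b}|lebesgue. f x powr p * x powr \<epsilon>)"
      by (simp add: L_def R_def)
  qed
  have least: "Inf X \<le> d" if "hardy_inequality a b p \<epsilon> d" for d
    using that bdd by (intro cInf_lower) (auto simp: X_def)
  have "hardy_const a b p \<epsilon> = Inf X"
    unfolding hardy_const_def by (intro Least_equality Inf least)
  then show "hardy_inequality a b p \<epsilon> (hardy_const a b p \<epsilon>)"
    and "hardy_inequality a b p \<epsilon> d \<Longrightarrow> hardy_const a b p \<epsilon> \<le> d"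
    using Inf least by simp_all
qed

section \<open>Comparison with the stated constants\<close>

text \<open>The second bound makes the final choice of \<open>\<kappa>\<close> admissible for the
  cosine weight. For p <= 3 the angle is at most pi/2 and the root at most 1, with one of the two
  strict. For larger p, \<open>arctan y \<le> y\<close> bounds the product by 1, since p - 1 <= 4 (p
  - 2).\<close>

lemma hardy_angle_bounds:
  assumes "2 \<le> p"
  shows "0 < hardy_angle p" and "hardy_angle p * sqrt ((p - 1) / 2) < pi / 2"
proof -
  show pos: "0 < hardy_angle p" using assms by (simp add: hardy_angle_def)
  consider "p = 2" | "2 < p" "p \<le> 3" | "3 < p" using assms by linarith
  then show "hardy_angle p * sqrt ((p - 1) / 2) < pi / 2"
  proof cases
    case 1
    then show ?thesis by (simp add: hardy_angle_def)
  next
    case 2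
    then have "hardy_angle p < pi / 2"
      using arctan_ubound[of "1 / sqrt (2 * (p - 2))"] by (simp add: hardy_angle_def)
    moreover have "sqrt ((p - 1) / 2) \<le> 1" using 2 by simp
    ultimately show ?thesis
      using pos by (smt (verit) mult_left_le)
  next
    case 3
    then have "hardy_angle p \<le> 1 / sqrt (2 * (p - 2))"
      by (simp add: hardy_angle_def arctan_le_self)
    then have "hardy_angle p * sqrt ((p - 1) / 2) \<le> 1 / sqrt (2 * (p - 2)) * sqrt ((p - 1) / 2)"
      using 3 by (intro mult_right_mono) auto
    also have "\<dots> = sqrt (1 / (2 * (p - 2)) * ((p - 1) / 2))"
      by (simp only: real_sqrt_mult real_sqrt_divide real_sqrt_one)
    also have "\<dots> \<le> 1" using 3 by (simp add: field_simps)
    also have "1 < pi / 2" using pi_gt3 by simp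
    finally show ?thesis .
  qed
qed

text \<open>The only place where b / a > b_0 enters: T stands for k ln (b / a) and r for p - 1.\<close>

lemma one_plus_quotient_le_of_large:
  fixes A T r :: real
  assumes r: "0 < r" and T: "2 * pi\<^sup>2 * r\<^sup>2 \<le> T\<^sup>2" "0 < T"
  shows "1 / (1 + r * A\<^sup>2 / (2 * T\<^sup>2))
    \<le> 1 - 2 * pi\<^sup>2 * r\<^sup>2 * A\<^sup>2 / (4 * pi\<^sup>2 * r + A\<^sup>2) / T\<^sup>2"
proof -
  have N: "4 * pi\<^sup>2 * r + A\<^sup>2 > 0" using r by (simp add: add_pos_nonneg)
  have M: "2 * T\<^sup>2 + r * A\<^sup>2 > 0" using r T by (simp add: add_pos_nonneg)
  have "2 * pi\<^sup>2 * r\<^sup>2 * A\<^sup>2 * (2 * T\<^sup>2 + r * A\<^sup>2) \<le> r * A\<^sup>2 * ((4 * pi\<^sup>2 * r + A\<^sup>2) * T\<^sup>2)"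
  proof -
    \<comment> \<open>After clearing denominators the terms
      \<open>4 * pi\<^sup>2 * r\<^sup>2 * A\<^sup>2 * T\<^sup>2\<close> on the two sides cancel,
      leaving the hypothesis on T times \<open>r * A\<^sup>2 * A\<^sup>2\<close>.\<close>
    have "r * A\<^sup>2 * A\<^sup>2 * (2 * pi\<^sup>2 * r\<^sup>2) \<le> r * A\<^sup>2 * A\<^sup>2 * T\<^sup>2"
      using r T by (intro mult_left_mono) auto
    then show ?thesis by (simp add: algebra_simps power2_eq_square)
  qed
  then have "2 * pi\<^sup>2 * r\<^sup>2 * A\<^sup>2 / ((4 * pi\<^sup>2 * r + A\<^sup>2) * T\<^sup>2) \<le> r * A\<^sup>2 / (2 * T\<^sup>2 + r * A\<^sup>2)"
    using N M T by (simp add: divide_le_eq le_divide_eq mult_ac)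
  moreover have "1 / (1 + r * A\<^sup>2 / (2 * T\<^sup>2)) = 1 - r * A\<^sup>2 / (2 * T\<^sup>2 + r * A\<^sup>2)"
  proof -
    have "1 + r * A\<^sup>2 / (2 * T\<^sup>2) = (2 * T\<^sup>2 + r * A\<^sup>2) / (2 * T\<^sup>2)"
      using T by (simp add: add_divide_distrib)
    then show ?thesis using M by (simp add: field_simps)
  qed
  ultimately show ?thesis by simp
qed

theorem corollary1p5:
  fixes p \<epsilon> a b :: real
  assumes "2 \<le> p" and "\<epsilon> < p - 1"
    and "0 < a" and "a < b" and "b / a > hardy_b0 p \<epsilon>"
  shows "(p / (p - 1 - \<epsilon>)) powr p - hardy_C1 p \<epsilon> / (ln (b / a))\<^sup>2 \<le> hardy_const a b p \<epsilon>
    \<and> hardy_const a b p \<epsilon> \<le> (p / (p - 1 - \<epsilon>)) powr p - hardy_C2 p \<epsilon> / (ln (b / a))\<^sup>2"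
proof -
  define k where "k = (p - 1 - \<epsilon>) / p"
  define L where "L = ln (b / a)"
  define \<nu> where "\<nu> = pi / L"
  define A where "A = hardy_angle p"
  \<comment> \<open>Chosen so that \<open>\<kappa>\<^sup>2 / k\<^sup>2 = (p - 1) * A\<^sup>2 / (2 *
    T\<^sup>2)\<close> with \<open>T = k * L\<close>, the form in
    \<open>one_plus_quotient_le_of_large\<close>.\<close>
  define \<kappa> where "\<kappa> = A * sqrt ((p - 1) / 2) / L"
  define K where "K = k powr (- p)"
  have k: "k > 0" using assms by (simp add: k_def)
  have L: "L > 0" using assms by (simp add: L_def)
  have A: "A > 0" "A * sqrt ((p - 1) / 2) < pi / 2"
    using hardy_angle_bounds[OF assms(1)] by (simp_all add: A_def)
  have K: "K > 0" using k by (simp add: K_def)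
  have base: "(p / (p - 1 - \<epsilon>)) powr s = k powr (- s)" for s
  proof -
    have "p / (p - 1 - \<epsilon>) = inverse k" by (simp add: k_def)
    then show ?thesis using k by (simp add: powr_minus inverse_powr)
  qed
  have K2: "k powr (- p - 2) = K / k\<^sup>2"
    using k by (simp add: K_def powr_diff)
  have upper: "hardy_inequality a b p \<epsilon> (k powr (2 - p) / (k\<^sup>2 + \<kappa>\<^sup>2))"
    using assms A L by (intro hardy_inequality_of_cos_weight) (auto simp: k_def \<kappa>_def L_def)
  have lower: "(k\<^sup>2 + \<nu>\<^sup>2) powr (- (p / 2)) \<le> d" if "hardy_inequality a b p \<epsilon> d" for d
    using assms that by (intro hardy_inequality_lower_bound) (auto simp: k_def \<nu>_def L_def)
  have const: "hardy_inequality a b p \<epsilon> (hardy_const a b p \<epsilon>)"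
    "hardy_inequality a b p \<epsilon> d \<Longrightarrow> hardy_const a b p \<epsilon> \<le> d" for d
    using hardy_inequality_hardy_const[OF upper lower] by blast+
  have "K - hardy_C1 p \<epsilon> / L\<^sup>2 \<le> hardy_const a b p \<epsilon>"
  proof -
    \<comment> \<open>The last factor of \<open>hardy_C1\<close>. The tangent-line bound at exponent
      \<open>- (p / 2)\<close> yields the slope \<open>p / 2\<close>, and both branches of q
      dominate it.\<close>
    define q where "q = (if p \<le> 3 then p - 7 / 8 else 2 * p\<^sup>2 - 4 * p + 1)"
    have q: "p / 2 \<le> q"
    proof (cases "p \<le> 3")
      case False
      then have "p * 3 \<le> p * p" by (intro mult_left_mono) auto
      then have "p / 2 \<le> 2 * (p * p) - 4 * p + 1" using False by linarith
      then show ?thesis using False by (simp add: q_def power2_eq_square)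
    qed (use assms in \<open>simp add: q_def\<close>)
    define z where "z = (\<nu> / k)\<^sup>2"
    have "hardy_C1 p \<epsilon> / L\<^sup>2 = K * (q * z)"
      by (simp add: hardy_C1_def base K2 q_def z_def \<nu>_def power_divide power_mult_distrib mult_ac)
    then have "K - hardy_C1 p \<epsilon> / L\<^sup>2 = K * (1 - q * z)" by (simp add: algebra_simps)
    also have "\<dots> \<le> K * (1 - p / 2 * z)"
      using K q by (intro mult_left_mono diff_left_mono mult_right_mono) (auto simp: z_def)
    also have "\<dots> \<le> K * (1 + z) powr (- (p / 2))"
      using K assms by (intro mult_left_mono one_plus_powr_minus_ge) (auto simp: z_def)
    also have "K * (1 + z) powr (- (p / 2)) = (k\<^sup>2 + \<nu>\<^sup>2) powr (- (p / 2))"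
    proof -
      have "k\<^sup>2 + \<nu>\<^sup>2 = k\<^sup>2 * (1 + z)" using k by (simp add: z_def field_simps)
      moreover have "K = (k\<^sup>2) powr (- (p / 2))"
        using k by (simp add: K_def powr_powr flip: powr_numeral)
      ultimately show ?thesis by (simp add: powr_mult z_def)
    qed
    also have "(k\<^sup>2 + \<nu>\<^sup>2) powr (- (p / 2)) \<le> hardy_const a b p \<epsilon>"
      by (rule lower[OF const(1)])
    finally show ?thesis .
  qed
  moreover have "hardy_const a b p \<epsilon> \<le> K - hardy_C2 p \<epsilon> / L\<^sup>2"
  proof -
    define T where "T = k * L"
    have T: "T > 0" using k L by (simp add: T_def)
    \<comment> \<open>The logarithm of \<open>b / a > hardy_b0 p \<epsilon>\<close>. Multiplied by k
      and squared, it becomes the lower bound on \<open>T\<^sup>2\<close> demanded by the quotient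
      lemma.\<close>
    have "sqrt 2 * pi * p * (p - 1) / (p - 1 - \<epsilon>) < L"
    proof -
      have "0 < hardy_b0 p \<epsilon>" by (simp add: hardy_b0_def)
      then have "ln (hardy_b0 p \<epsilon>) < L" using assms by (simp add: L_def)
      then show ?thesis by (simp add: hardy_b0_def)
    qed
    then have "sqrt 2 * pi * (p - 1) \<le> T"
      using assms by (simp add: T_def k_def field_simps)
    then have "(sqrt 2 * pi * (p - 1))\<^sup>2 \<le> T\<^sup>2"
      using assms by (intro power_mono) auto
    then have T2: "2 * pi\<^sup>2 * (p - 1)\<^sup>2 \<le> T\<^sup>2" by (simp add: power_mult_distrib)
    have kappa2: "\<kappa>\<^sup>2 = k\<^sup>2 * ((p - 1) * A\<^sup>2 / (2 * T\<^sup>2))"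
      using assms k by (simp add: \<kappa>_def T_def power_mult_distrib power_divide mult_ac)
    have "hardy_const a b p \<epsilon> \<le> k powr (2 - p) / (k\<^sup>2 + \<kappa>\<^sup>2)"
      by (rule const(2)[OF upper])
    also have "\<dots> = K * (1 / (1 + (p - 1) * A\<^sup>2 / (2 * T\<^sup>2)))"
    proof -
      have "k powr (2 - p) = k\<^sup>2 * K" using k by (simp add: K_def powr_diff powr_minus divide_inverse)
      moreover have "k\<^sup>2 + \<kappa>\<^sup>2 = k\<^sup>2 * (1 + (p - 1) * A\<^sup>2 / (2 * T\<^sup>2))"
        unfolding kappa2 by (simp add: algebra_simps)
      ultimately show ?thesis using k by simp
    qed
    also have "\<dots> \<le> K * (1 - 2 * pi\<^sup>2 * (p - 1)\<^sup>2 * A\<^sup>2 / (4 * pi\<^sup>2 * (p - 1) + A\<^sup>2) / T\<^sup>2)"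
      using K assms T T2 by (intro mult_left_mono one_plus_quotient_le_of_large) auto
    also have "\<dots> = K - hardy_C2 p \<epsilon> / L\<^sup>2"
    proof -
      have "hardy_C2 p \<epsilon> / L\<^sup>2
          = K * (2 * pi\<^sup>2 * (p - 1)\<^sup>2 * A\<^sup>2 / (4 * pi\<^sup>2 * (p - 1) + A\<^sup>2) / T\<^sup>2)"
        by (simp add: hardy_C2_def base K2 A_def T_def power_mult_distrib mult_ac)
      then show ?thesis by (simp add: right_diff_distrib)
    qed
    finally show ?thesis .
  qed
  ultimately show ?thesis
    by (simp add: base K_def L_def)
qed

end
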